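(* There exists a unit-regular ring $R$ of cardinality $\aleph_1$ and index of nilpotence $3$ such that the lattice $\mathbb{L}(R)$ has no Banaschewski function.
   Context: A unital ring $R$ is unit-regular if for every $x\in R$ there is an invertible $u\in R$ with $xux=x$. The index of nilpotence of a nilpotent element $a$ of a ring $T$ is the least positive integer $n$ with $a^n=0$; the index (of nilpotence) of $T$ is the supremum of the indices of all nilpotent elements of $T$. For a (von Neumann) regular ring $R$, $\mathbb{L}(R):=\{xR\mid x\in R\}$ denotes the lattice of all principal right ideals of $R$, ordered by inclusion (for $R$ unital it is a complemented modular lattice, with zero $\{0\}$ and unit $R$). A Banaschewski function on a bounded lattice $L$ is an antitone (order-reversing) map $f\colon L\to L$ such that $x\wedge f(x)=0$ and $x\vee f(x)=1$ for each $x\in L$. *)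

theory Defs
  imports "HOL-Algebra.Algebra" "HOL-Library.Extended_Nat"
begin

unbundle cardinal_syntax

definition unit_regular_ring :: "('a, 'm) ring_scheme \<Rightarrow> bool" where
  "unit_regular_ring R \<longleftrightarrow>
     ring R \<and> (\<forall>x \<in> carrier R. \<exists>u \<in> Units R. x \<otimes>\<^bsub>R\<^esub> u \<otimes>\<^bsub>R\<^esub> x = x)"

definition nilpotent_elements :: "('a, 'm) ring_scheme \<Rightarrow> 'a set" where
  "nilpotent_elements R = {a \<in> carrier R. \<exists>n>0. a [^]\<^bsub>R\<^esub> (n::nat) = \<zero>\<^bsub>R\<^esub>}"

definition element_nilpotence_index :: "('a, 'm) ring_scheme \<Rightarrow> 'a \<Rightarrow> nat" where
  "element_nilpotence_index R a = (LEAST n. n > 0 \<and> a [^]\<^bsub>R\<^esub> n = \<zero>\<^bsub>R\<^esub>)"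

definition nilpotence_index :: "('a, 'm) ring_scheme \<Rightarrow> enat" where
  "nilpotence_index R = (SUP a \<in> nilpotent_elements R. enat (element_nilpotence_index R a))"

definition principal_right_ideals :: "('a, 'm) ring_scheme \<Rightarrow> 'a set gorder" where
  "principal_right_ideals R =
     \<lparr> carrier = {x <#\<^bsub>R\<^esub> carrier R | x. x \<in> carrier R}, eq = (=), le = (\<subseteq>) \<rparr>"

(* Meet, join, bottom and top are those determined by the order of L; the notion is only
   meaningful when L is a bounded lattice, as principal_right_ideals R is for every
   (von Neumann) regular ring R with unit. *)
definition banaschewski_function :: "('a, 'm) gorder_scheme \<Rightarrow> ('a \<Rightarrow> 'a) \<Rightarrow> bool" where
  "banaschewski_function L f \<longleftrightarrow>
     f \<in> carrier L \<rightarrow> carrier L \<and>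
     (\<forall>x \<in> carrier L. \<forall>y \<in> carrier L. x \<sqsubseteq>\<^bsub>L\<^esub> y \<longrightarrow> f y \<sqsubseteq>\<^bsub>L\<^esub> f x) \<and>
     (\<forall>x \<in> carrier L. x \<sqinter>\<^bsub>L\<^esub> f x = \<bottom>\<^bsub>L\<^esub> \<and> x \<squnion>\<^bsub>L\<^esub> f x = \<top>\<^bsub>L\<^esub>)"

(* For A the carrier of a ring over the element type "nat set": this type has cardinality
   2 ^ aleph_0 >= aleph_1, so every ring of cardinality aleph_1 has an isomorphic copy there. *)
definition has_cardinality_aleph1 :: "'a set \<Rightarrow> bool" where
  "has_cardinality_aleph1 A \<longleftrightarrow> |A| =o cardSuc natLeq"

end

(* Take K = M_3(GF(2)), an index set I of size aleph_1 and the ring S of those functions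
   phi : I x I -> K for which some finite D within I and l in {0, 1} satisfy, for i in D and
   j outside D, phi(i, j) = phi(i, i) and phi(j, i) = u phi(i, i) u, while phi = l off rows and
   columns in D. Here u = 1 + N with N = E_12, so u is an involution. S is a directed
   union of finite products of copies of GF(2) and K, hence unit-regular of index 3.
   Let X_i in S have value E = E_11 along row i. A Banaschewski function yields idempotents e(X_i)
   in X_i S, and each of them is governed by a finite set D_i. If j is outside D_i and i outside D_j,
   then X_i and X_j generate the same ideal at the point (i, j), so antitonicity through an element
   supported at that point forces e(X_i)(i, i) = u e(X_j)(j, j) u. By pigeonhole, uncountably many i
   share the same value c = e(X_i)(i, i), and any uncountable set contains such a pair i, j; so c
   commutes with N. But c is an idempotent with the same image as E, for which N c = 0 and c N = N. *)

theory Submission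
  imports Defs "HOL-Analysis.Cartesian_Space" "HOL-Library.Z2" "HOL-Library.Function_Algebras"
    "HOL-Library.Countable_Set_Type"
begin

section \<open>Square matrices over a field: unit-regularity and nilpotence\<close>

text \<open>A basis \<open>B\<close> of the kernel extends to a basis \<open>C\<close> of the whole
  space, and \<open>A\<close> is injective on the span of \<open>D = C - B\<close>. The inverse of
  \<open>A\<close> on the image of \<open>D\<close> extends to an injective, hence invertible,
  linear map \<open>U\<close>. Then \<open>A ** U ** A\<close> and \<open>A\<close> agree on
  \<open>C\<close>: both vanish on \<open>B\<close>, and \<open>U\<close> undoes \<open>A\<close> on
  \<open>D\<close>.\<close>

lemma matrix_unit_regular:
  fixes A :: "'a::field^'n^'n"
  obtains U where "invertible U" "A ** U ** A = A"
proof -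
  obtain B where B: "B \<subseteq> {v. A *v v = 0}" "vec.independent B" "{v. A *v v = 0} \<subseteq> vec.span B"
    using vec.basis_exists by metis
  obtain C where C: "B \<subseteq> C" "vec.independent C" "UNIV \<subseteq> vec.span C"
    using vec.maximal_independent_subset_extend[OF subset_UNIV B(2)] by metis
  define D where "D = C - B"
  have indD: "vec.independent D"
    using C(2) D_def vec.independent_mono[of C D] by blast
  \<comment> \<open>A kernel vector in the span of \<open>D\<close> has coordinates over
    \<open>C\<close> supported both in \<open>D\<close> and in \<open>B\<close>, so they all
    vanish.\<close>
  have inj0: "v = 0" if v: "v \<in> vec.span D" "A *v v = 0" for v
  proof -
    have vB: "v \<in> vec.span B" using B(3) v(2) by blast
    have "vec.representation C v = vec.representation D v"
      using vec.representation_extend[OF C(2) v(1)] by (simp add: D_def)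
    moreover have "vec.representation C v = vec.representation B v"
      using vec.representation_extend[OF C(2) vB C(1)] .
    ultimately have "vec.representation C v b = 0" for b
      using vec.representation_ne_zero[of D v b] vec.representation_ne_zero[of B v b]
      by (auto simp: D_def)
    then show ?thesis
      using vec.sum_nonzero_representation_eq[OF C(2), of v] C(3) by auto
  qed
  have injA: "inj_on ((*v) A) (vec.span D)"
  proof (rule inj_onI)
    fix v w assume "v \<in> vec.span D" "w \<in> vec.span D" "A *v v = A *v w"
    then show "v = w" using inj0[of "v - w"]
      by (simp add: vec.span_diff matrix_vector_mult_diff_distrib)
  qed
  then have injD: "inj_on ((*v) A) D"
    using inj_on_subset vec.span_superset by blast
  define g where "g = inv_into D ((*v) A)"
  have gD: "g ` ((*v) A ` D) = D"
    unfolding g_def using injD by (simp add: inv_into_image_cancel)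
  have "vec.independent ((*v) A ` D)"
    by (rule vec.independent_injective_image[OF indD injA])
  \<comment> \<open>The extension can be made injective because \<open>g\<close> maps an independent
    set injectively onto the independent set \<open>D\<close>.\<close>
  then obtain f where f: "Vector_Spaces.linear (*s) (*s) f" "inj f" "\<And>v. v \<in> (*v) A ` D \<Longrightarrow> f v = g v"
    using vec.linear_independent_extend_inj[of "(*v) A ` D" g] gD indD
    by (auto simp: g_def inj_on_inv_into)
  define U where "U = matrix f"
  have U: "(*v) U = f"
    using f(1) by (simp add: U_def matrix_works fun_eq_iff)
  have "invertible U"
    using f(2) unfolding invertible_left_inverse matrix_left_invertible_injective
    by (simp add: U)
  moreover have "A ** U ** A = A"
  proof -
    have "A ** U ** A *v v = A *v v" for v
    proof (rule vec.linear_eq_on[OF matrix_vector_mul_linear_gen matrix_vector_mul_linear_gen, of v C])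
      fix b assume "b \<in> C"
      show "A ** U ** A *v b = A *v b"
      proof (cases "b \<in> B")
        case True
        then have "A *v b = 0" using B(1) by blast
        then show ?thesis by (simp flip: matrix_vector_mul_assoc)
      next
        case False
        then have "b \<in> D" using \<open>b \<in> C\<close> D_def by blast
        then have "f (A *v b) = b" using f(3) injD by (simp add: g_def)
        then show ?thesis by (simp add: U flip: matrix_vector_mul_assoc)
      qed
    qed (use C(3) in auto)
    then show ?thesis by (simp add: matrix_eq)
  qed
  ultimately show ?thesis by (rule that)
qed

lemma matrix_add_rdistrib:
  fixes A B :: "'a::semiring_1^'n^'m"
  shows "(A + B) ** C = A ** C + B ** C"
  by (simp add: vec_eq_iff matrix_matrix_mult_def distrib_right sum.distrib)

text \<open>On \<open>vec\<close> the class operation \<open>*\<close> is componentwise. A separate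
  type lets \<open>*\<close> be the matrix product, so that matrices form an instance of
  \<open>ring_1\<close>.\<close>

typedef ('a, 'n) square_matrix = "UNIV :: (('a, 'n::finite) vec, 'n) vec set" ..

setup_lifting type_definition_square_matrix

instantiation square_matrix :: (field, finite) ring_1
begin
lift_definition zero_square_matrix :: "('a, 'b) square_matrix" is 0 .
lift_definition one_square_matrix :: "('a, 'b) square_matrix" is "mat 1" .
lift_definition plus_square_matrix :: "('a, 'b) square_matrix \<Rightarrow> ('a, 'b) square_matrix \<Rightarrow> ('a, 'b) square_matrix" is "(+)" .
lift_definition minus_square_matrix :: "('a, 'b) square_matrix \<Rightarrow> ('a, 'b) square_matrix \<Rightarrow> ('a, 'b) square_matrix" is "(-)" .
lift_definition uminus_square_matrix :: "('a, 'b) square_matrix \<Rightarrow> ('a, 'b) square_matrix" is "uminus" .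
lift_definition times_square_matrix :: "('a, 'b) square_matrix \<Rightarrow> ('a, 'b) square_matrix \<Rightarrow> ('a, 'b) square_matrix" is "(**)" .
instance
proof
  have "(mat 1 :: 'a^'b^'b) \<noteq> 0"
    by (simp add: mat_def vec_eq_iff)
  then show "(0::('a,'b) square_matrix) \<noteq> 1" by transfer simp
qed (transfer; simp add: matrix_mul_assoc matrix_add_ldistrib matrix_add_rdistrib)+
end

lemma square_matrix_unit_regular:
  fixes x :: "('a::field, 'n::finite) square_matrix"
  obtains u v where "u * v = 1" "v * u = 1" "x * u * x = x"
proof -
  have "\<exists>u v. u * v = 1 \<and> v * u = 1 \<and> x * u * x = x"
    by transfer (metis matrix_unit_regular invertible_def)
  then show ?thesis using that by blast
qed

lift_definition matrix_range :: "('a::field, 'n::finite) square_matrix \<Rightarrow> ('a^'n) set" is "\<lambda>A. range ((*v) A)" .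

lemma matrix_range_mult: "matrix_range (x * y) = (*v) (Rep_square_matrix x) ` matrix_range y"
  by transfer (auto simp: image_image simp flip: matrix_vector_mul_assoc)

lemma matrix_range_mult_subset: "matrix_range (x * y) \<subseteq> matrix_range x"
  by transfer (auto simp flip: matrix_vector_mul_assoc)

lemma subspace_matrix_range: "vec.subspace (matrix_range x)"
  by transfer (simp add: vec.subspace_image)

lemma matrix_range_eq_0_iff: "matrix_range x = {0} \<longleftrightarrow> x = 0"
  by transfer (auto simp: matrix_eq)

text \<open>The ranges of the powers of \<open>x\<close> form a decreasing chain that is constant
  once two consecutive members agree. Nilpotency makes the final value zero, so the dimension drops
  at every step until it is 0, which takes at most \<open>CARD('n)\<close> steps.\<close>

lemma square_matrix_nilpotent:
  fixes x :: "('a::field, 'n::finite) square_matrix"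
  assumes "x ^ m = 0"
  shows "x ^ CARD('n) = 0"
proof -
  define V where "V k = matrix_range (x ^ k)" for k
  have sub: "vec.subspace (V k)" for k
    unfolding V_def by (rule subspace_matrix_range)
  have V_Suc: "V (Suc k) = (*v) (Rep_square_matrix x) ` V k" for k
    unfolding V_def by (simp add: matrix_range_mult)
  have le: "V (Suc k) \<subseteq> V k" for k
    unfolding V_def power_Suc2 by (rule matrix_range_mult_subset)
  have "V k = {0}" if eq: "V (Suc k) = V k" for k
  proof -
    have "V (k + j) = V k" for j
      by (induction j) (use V_Suc eq in auto)
    moreover have "x ^ (k + m) = 0" using assms by (simp add: power_add)
    then have "V (k + m) = {0}" by (simp add: V_def matrix_range_eq_0_iff)
    ultimately show ?thesis by metis
  qed
  note stable = this
  \<comment> \<open>The subtraction on naturals is truncated, which is harmless: where the chain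
    stalls, the dimension is already 0.\<close>
  have "vec.dim (V k) \<le> CARD('n) - k" for k
  proof (induction k)
    case 0
    show ?case by (simp add: dim_subset_UNIV_cart_gen)
  next
    case (Suc k)
    show ?case
    proof (cases "V (Suc k) = V k")
      case True
      then show ?thesis using stable[of k] by simp
    next
      case False
      then have "vec.dim (V (Suc k)) < vec.dim (V k)"
        using vec.subspace_dim_equal[OF sub sub le] by (meson le_less_linear)
      with Suc show ?thesis by linarith
    qed
  qed
  from this[of "CARD('n)"] have "V CARD('n) \<subseteq> {0}" by (simp add: vec.dim_eq_0)
  then have "V CARD('n) = {0}" using vec.subspace_0[OF sub] by blast
  then show ?thesis by (simp add: V_def matrix_range_eq_0_iff)
qed

instance bit :: finite
  proof
  have "(UNIV :: bit set) = {0, 1}" by (auto simp: bit_not_zero_iff)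
  then show "finite (UNIV :: bit set)" by (metis finite.simps)
qed

lift_definition matrix_unit :: "'n \<Rightarrow> 'n \<Rightarrow> ('a::field, 'n::finite) square_matrix"
  is "\<lambda>k l. \<chi> i j. if i = k \<and> j = l then 1 else 0" .

lemma matrix_unit_mult:
  "matrix_unit i j * matrix_unit k l = (if j = k then matrix_unit i l else 0)"
  by transfer (auto simp: vec_eq_iff matrix_matrix_mult_def if_distrib[of "\<lambda>x. x * _"] cong: if_cong)

lemma matrix_unit_nonzero: "matrix_unit i j \<noteq> 0"
  by transfer (auto simp: vec_eq_iff)

lemma square_matrix_bit_char_2: "(1 :: (bit, 'n::finite) square_matrix) + 1 = 0"
  by transfer (simp add: vec_eq_iff)

lemma finite_square_matrix: "finite (UNIV :: ('a::finite, 'n::finite) square_matrix set)"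
proof -
  have "inj (Rep_square_matrix :: ('a, 'n) square_matrix \<Rightarrow> _)"
    by (simp add: inj_on_def Rep_square_matrix_inject)
  then show ?thesis by (rule finite_imageD[rotated]) simp
qed

section \<open>Principal right ideals of regular rings\<close>

definition regular_ring :: "('a, 'm) ring_scheme \<Rightarrow> bool" where
  "regular_ring R \<longleftrightarrow> ring R \<and> (\<forall>x \<in> carrier R. \<exists>y \<in> carrier R. x \<otimes>\<^bsub>R\<^esub> y \<otimes>\<^bsub>R\<^esub> x = x)"

lemma unit_regular_imp_regular: "unit_regular_ring R \<Longrightarrow> regular_ring R"
  unfolding unit_regular_ring_def regular_ring_def Units_def by blast

context ring begin

lemma add_eq_imp_eq_minus:
  assumes "a \<in> carrier R" "b \<in> carrier R" "a \<oplus> b = c"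
  shows "b = c \<ominus> a"
proof -
  have "a \<oplus> b \<ominus> a = b"
    using assms(1,2) by (simp add: minus_eq add.m_comm[of a b] add.m_assoc r_neg)
  then show ?thesis using assms(3) by simp
qed

lemma mem_l_coset_carrier: "t \<in> x <# carrier R \<longleftrightarrow> (\<exists>r \<in> carrier R. t = x \<otimes> r)"
  by (auto simp: l_coset_def)

lemma mem_own_l_coset: "x \<in> carrier R \<Longrightarrow> x \<in> x <# carrier R"
  by (metis mem_l_coset_carrier one_closed r_one)

lemma l_coset_carrier_subset:
  assumes "x \<in> carrier R" "y \<in> carrier R"
  shows "x <# carrier R \<subseteq> y <# carrier R \<longleftrightarrow> (\<exists>r \<in> carrier R. x = y \<otimes> r)"
proof
  assume "x <# carrier R \<subseteq> y <# carrier R"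
  then show "\<exists>r \<in> carrier R. x = y \<otimes> r"
    using mem_own_l_coset[OF assms(1)] mem_l_coset_carrier by blast
next
  assume "\<exists>r \<in> carrier R. x = y \<otimes> r"
  then show "x <# carrier R \<subseteq> y <# carrier R"
    using assms by (auto simp: mem_l_coset_carrier m_assoc intro!: bexI)
qed

text \<open>If \<open>y\<close> is an inner inverse of \<open>x\<close>, then
  \<open>x \<otimes> y\<close> is the required idempotent.\<close>

lemma regular_l_coset_idem:
  assumes "regular_ring R" "x \<in> carrier R"
  obtains e where "e \<in> carrier R" "e \<otimes> e = e" "e \<otimes> x = x" "e <# carrier R = x <# carrier R"
proof -
  obtain y where y: "y \<in> carrier R" "x \<otimes> y \<otimes> x = x"
    using assms by (auto simp: regular_ring_def)
  show ?thesis
  proof (rule that[of "x \<otimes> y"])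
    show "(x \<otimes> y) <# carrier R = x <# carrier R"
      using assms(2) y by (intro equalityI; simp add: l_coset_carrier_subset; metis)
    show "x \<otimes> y \<otimes> (x \<otimes> y) = x \<otimes> y"
      using assms(2) y by (simp flip: m_assoc)
  qed (use assms(2) y in auto)
qed

text \<open>For idempotent generators \<open>e\<close> and \<open>f\<close>, an element fixed by
  \<open>f\<close> lies in the ideal of \<open>e\<close> exactly when
  \<open>k = (\<one> \<ominus> e) \<otimes> f\<close> annihilates it. The right annihilator of
  \<open>k\<close> is generated by \<open>m = \<one> \<ominus> k' \<otimes> k\<close>, so
  \<open>f \<otimes> m\<close> generates the intersection.\<close>

lemma regular_inter_principal:
  assumes reg: "regular_ring R" and x: "x \<in> carrier R" and y: "y \<in> carrier R"
  obtains z where "z \<in> carrier R" "(x <# carrier R) \<inter> (y <# carrier R) = z <# carrier R"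
proof -
  obtain e where e: "e \<in> carrier R" "e \<otimes> e = e" "e <# carrier R = x <# carrier R"
    using regular_l_coset_idem[OF reg x] by metis
  obtain f where f: "f \<in> carrier R" "f \<otimes> f = f" "f <# carrier R = y <# carrier R"
    using regular_l_coset_idem[OF reg y] by metis
  define k where "k = (\<one> \<ominus> e) \<otimes> f"
  have k: "k \<in> carrier R" using e f by (simp add: k_def)
  obtain k' where k': "k' \<in> carrier R" "k \<otimes> k' \<otimes> k = k"
    using reg k by (auto simp: regular_ring_def)
  define m where "m = \<one> \<ominus> k' \<otimes> k"
  have m: "m \<in> carrier R" using k k' by (simp add: m_def)
  have km: "k \<otimes> m = \<zero>"
    using k k' by (simp add: m_def minus_eq r_distr r_minus r_neg flip: m_assoc)
  have efm: "e \<otimes> (f \<otimes> m) = f \<otimes> m"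
  proof -
    have "f \<otimes> m \<ominus> e \<otimes> (f \<otimes> m) = k \<otimes> m"
      using e f m by (simp add: k_def minus_eq l_distr l_minus m_assoc)
    then show ?thesis using km e f m by (metis m_closed r_right_minus_eq)
  qed
  have "(x <# carrier R) \<inter> (y <# carrier R) = (f \<otimes> m) <# carrier R"
  proof (intro equalityI subsetI)
    fix t assume "t \<in> (x <# carrier R) \<inter> (y <# carrier R)"
    then obtain r s where r: "r \<in> carrier R" "t = e \<otimes> r" and s: "s \<in> carrier R" "t = f \<otimes> s"
      unfolding e(3)[symmetric] f(3)[symmetric] by (auto simp: mem_l_coset_carrier)
    have t: "t \<in> carrier R" "e \<otimes> t = t"
      using r e by (simp_all flip: m_assoc)
    have ft: "f \<otimes> t = t"
      using s f by (simp flip: m_assoc)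
    have "k \<otimes> t = \<zero>"
      using t ft e f by (simp add: k_def m_assoc minus_eq l_distr l_minus r_neg)
    then have "f \<otimes> m \<otimes> t = t"
      using t ft f k k' by (simp add: m_def m_assoc minus_eq l_distr l_minus)
    then show "t \<in> (f \<otimes> m) <# carrier R" using t by (metis mem_l_coset_carrier)
  next
    fix t assume "t \<in> (f \<otimes> m) <# carrier R"
    then obtain r where r: "r \<in> carrier R" "t = f \<otimes> m \<otimes> r" by (auto simp: mem_l_coset_carrier)
    have "t = e \<otimes> (f \<otimes> m \<otimes> r)" using efm r e f m by (simp flip: m_assoc)
    moreover have "t = f \<otimes> (m \<otimes> r)" using r f m by (simp add: m_assoc)
    ultimately show "t \<in> (x <# carrier R) \<inter> (y <# carrier R)"
      unfolding e(3)[symmetric] f(3)[symmetric] using r e f m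
      by (metis IntI m_closed mem_l_coset_carrier)
  qed
  then show ?thesis by (rule that[rotated]) (use f m in simp)
qed

text \<open>The element \<open>x \<otimes> s \<oplus> y \<otimes> t\<close> generates the sum of the
  two ideals: its form places it in the sum, and as a left identity on \<open>x\<close> and
  \<open>y\<close> it generates an ideal containing both.\<close>

lemma regular_sum_principal:
  assumes reg: "regular_ring R" and x: "x \<in> carrier R" and y: "y \<in> carrier R"
  obtains s t where "s \<in> carrier R" "t \<in> carrier R"
    "(x \<otimes> s \<oplus> y \<otimes> t) \<otimes> x = x" "(x \<otimes> s \<oplus> y \<otimes> t) \<otimes> y = y"
proof -
  obtain e where e: "e \<in> carrier R" "e \<otimes> e = e" "e \<otimes> x = x" "e <# carrier R = x <# carrier R"
    using regular_l_coset_idem[OF reg x] by metis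
  obtain s0 where s0: "s0 \<in> carrier R" "e = x \<otimes> s0"
    using mem_own_l_coset[OF e(1)] unfolding e(4) mem_l_coset_carrier by blast
  define k where "k = (\<one> \<ominus> e) \<otimes> y"
  have k: "k \<in> carrier R" using e y by (simp add: k_def)
  have yk: "y = e \<otimes> y \<oplus> k"
    using e y by (simp add: k_def minus_eq l_distr l_minus add.m_lcomm r_neg)
  obtain k' where k': "k' \<in> carrier R" "k \<otimes> k' \<otimes> k = k"
    using reg k by (auto simp: regular_ring_def)
  \<comment> \<open>With these \<open>s\<close> and \<open>t\<close> the combination becomes
    \<open>e \<oplus> k \<otimes> t\<close>. The factor \<open>\<one> \<ominus> e\<close> in
    \<open>t\<close> kills \<open>x\<close>, while on \<open>y\<close> the second summand supplies
    the part \<open>k\<close> that \<open>e\<close> misses.\<close>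
  define t where "t = k' \<otimes> (\<one> \<ominus> e)"
  define s where "s = s0 \<otimes> (\<one> \<ominus> y \<otimes> t)"
  have t: "t \<in> carrier R" using k' e by (simp add: t_def)
  have s: "s \<in> carrier R" using s0 t y by (simp add: s_def)
  have w: "x \<otimes> s \<oplus> y \<otimes> t = e \<oplus> k \<otimes> t"
    using x y s0 t e(1)
    by (simp add: s_def k_def minus_eq l_distr r_distr l_minus r_minus a_ac flip: m_assoc)
  have tx: "t \<otimes> x = \<zero>"
    using x e k' by (simp add: t_def m_assoc minus_eq l_distr l_minus r_neg)
  have ty: "t \<otimes> y = k' \<otimes> k"
    using y e k' by (simp add: t_def k_def m_assoc)
  show ?thesis
  proof (rule that[OF s t])
    show "(x \<otimes> s \<oplus> y \<otimes> t) \<otimes> x = x"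
      unfolding w using x e k t tx by (simp add: l_distr m_assoc)
    show "(x \<otimes> s \<oplus> y \<otimes> t) \<otimes> y = y"
      unfolding w using y e(1) k t k' ty yk by (simp add: l_distr m_assoc)
  qed
qed

end

section \<open>From Banaschewski functions to idempotents\<close>

text \<open>For an antitone choice of complements, the idempotents with image xR and kernel the
  chosen complement satisfy the identity below, so that the absence of a Banaschewski function
  becomes an equational question.\<close>

definition banaschewski_idempotents :: "('a, 'm) ring_scheme \<Rightarrow> ('a \<Rightarrow> 'a) \<Rightarrow> bool" where
  "banaschewski_idempotents R e \<longleftrightarrow>
     (\<forall>x \<in> carrier R. e x \<in> carrier R \<and> e x \<otimes>\<^bsub>R\<^esub> x = x \<and> (\<exists>r \<in> carrier R. e x = x \<otimes>\<^bsub>R\<^esub> r)) \<and>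
     (\<forall>x \<in> carrier R. \<forall>r \<in> carrier R. e (x \<otimes>\<^bsub>R\<^esub> r) \<otimes>\<^bsub>R\<^esub> e x = e (x \<otimes>\<^bsub>R\<^esub> r))"

text \<open>The lattice operations are given by Hilbert choice from the order, so each is identified
  through uniqueness of least and greatest elements: bottom is the zero ideal, top the ring, meet
  the intersection, join the sum of ideals. Complementation thus becomes a direct decomposition of
  the ring.\<close>

lemma (in ring) banaschewski_function_complement:
  assumes reg: "regular_ring R"
    and f: "banaschewski_function (principal_right_ideals R) f"
    and x: "x \<in> carrier R" and y: "y \<in> carrier R" and fx: "f (x <# carrier R) = y <# carrier R"
  shows "(x <# carrier R) \<inter> (y <# carrier R) = {\<zero>}"
    and "\<exists>r \<in> carrier R. \<exists>s \<in> carrier R. x \<otimes> r \<oplus> y \<otimes> s = \<one>"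
proof -
  let ?L = "principal_right_ideals R" and ?X = "x <# carrier R" and ?Y = "y <# carrier R"
  have L: "carrier ?L = {z <# carrier R | z. z \<in> carrier R}" "le ?L = (\<subseteq>)"
    by (auto simp: principal_right_ideals_def)
  have X: "?X \<in> carrier ?L" and Y: "?Y \<in> carrier ?L" unfolding L(1) using x y by blast+
  have meet: "?X \<sqinter>\<^bsub>?L\<^esub> ?Y = \<bottom>\<^bsub>?L\<^esub>" and join: "?X \<squnion>\<^bsub>?L\<^esub> ?Y = \<top>\<^bsub>?L\<^esub>"
    using f X unfolding banaschewski_function_def fx[symmetric] by auto
  have unique_least: "l = m" if "least ?L l A" "least ?L m A" for l m A
    using that unfolding least_def L(2) by (meson subset_antisym)
  have unique_greatest: "l = m" if "greatest ?L l A" "greatest ?L m A" for l m A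
    using that unfolding greatest_def L(2) by (meson subset_antisym)
  have zero: "\<zero> <# carrier R = {\<zero>}"
    by (auto simp: l_coset_def)
  have one: "\<one> <# carrier R = carrier R"
    by (auto simp: l_coset_def)
  have bot: "\<bottom>\<^bsub>?L\<^esub> = {\<zero>}"
    unfolding bottom_def
  proof (rule some_equality)
    show "least ?L {\<zero>} (carrier ?L)"
      unfolding least_def L using zero by (force simp: mem_l_coset_carrier intro: r_null[symmetric])
    then show "l = {\<zero>}" if "least ?L l (carrier ?L)" for l
      by (rule unique_least[OF that])
  qed
  have top: "\<top>\<^bsub>?L\<^esub> = carrier R"
    unfolding top_def
  proof (rule some_equality)
    show "greatest ?L (carrier R) (carrier ?L)"
      unfolding greatest_def L using one by (force simp: mem_l_coset_carrier)
    then show "l = carrier R" if "greatest ?L l (carrier ?L)" for l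
      by (rule unique_greatest[OF that])
  qed
  obtain z where z: "z \<in> carrier R" "?X \<inter> ?Y = z <# carrier R"
    using regular_inter_principal[OF reg x y] .
  then have XY: "?X \<inter> ?Y \<in> carrier ?L" unfolding L(1) by blast
  have "?X \<sqinter>\<^bsub>?L\<^esub> ?Y = ?X \<inter> ?Y"
    unfolding meet_def inf_def
  proof (rule some_equality)
    show "greatest ?L (?X \<inter> ?Y) (Lower ?L {?X, ?Y})"
      using XY X Y by (auto simp: greatest_def Lower_def L(2))
    then show "l = ?X \<inter> ?Y" if "greatest ?L l (Lower ?L {?X, ?Y})" for l
      by (rule unique_greatest[OF that])
  qed
  then show "?X \<inter> ?Y = {\<zero>}" using meet bot by metis
  obtain s t where st: "s \<in> carrier R" "t \<in> carrier R"
    and wx: "(x \<otimes> s \<oplus> y \<otimes> t) \<otimes> x = x" and wy: "(x \<otimes> s \<oplus> y \<otimes> t) \<otimes> y = y"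
    using regular_sum_principal[OF reg x y] .
  define w where "w = x \<otimes> s \<oplus> y \<otimes> t"
  have w: "w \<in> carrier R" using x y st by (simp add: w_def)
  have W: "w <# carrier R \<in> carrier ?L" unfolding L(1) using w by blast
  have "?X \<squnion>\<^bsub>?L\<^esub> ?Y = w <# carrier R"
    unfolding join_def sup_def
  proof (rule some_equality)
    have "?X \<subseteq> w <# carrier R" "?Y \<subseteq> w <# carrier R"
      using wx wy x y w by (metis l_coset_carrier_subset w_def)+
    then have WU: "w <# carrier R \<in> Upper ?L {?X, ?Y}"
      unfolding Upper_def L(2) using W by auto
    have "w <# carrier R \<subseteq> Z"
      if Z: "Z \<in> carrier ?L" "?X \<subseteq> Z" "?Y \<subseteq> Z" for Z
    proof -
      obtain z where z: "z \<in> carrier R" "Z = z <# carrier R"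
        using Z(1) unfolding L(1) by blast
      obtain a b where ab: "a \<in> carrier R" "x = z \<otimes> a" "b \<in> carrier R" "y = z \<otimes> b"
        using Z z x y by (meson l_coset_carrier_subset)
      then have "w = z \<otimes> (a \<otimes> s \<oplus> b \<otimes> t)"
        using z(1) st by (simp add: w_def r_distr m_assoc)
      then show ?thesis
        unfolding z(2) using z(1) w st ab(1,3) by (auto simp: l_coset_carrier_subset)
    qed
    moreover have "Z \<in> carrier ?L \<and> ?X \<subseteq> Z \<and> ?Y \<subseteq> Z" if "Z \<in> Upper ?L {?X, ?Y}" for Z
      using that X Y unfolding Upper_def L(2) by simp
    ultimately show "least ?L (w <# carrier R) (Upper ?L {?X, ?Y})"
      unfolding least_def L(2) using WU by (simp add: Upper_closed)
    then show "l = w <# carrier R" if "least ?L l (Upper ?L {?X, ?Y})" for l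
      by (rule unique_least[OF that])
  qed
  then have "w <# carrier R = carrier R" using join top by metis
  then have "\<one> \<in> w <# carrier R" using one_closed by metis
  then obtain r where r: "r \<in> carrier R" "\<one> = w \<otimes> r" unfolding mem_l_coset_carrier by blast
  moreover have "w \<otimes> r = x \<otimes> (s \<otimes> r) \<oplus> y \<otimes> (t \<otimes> r)"
    using x y st r(1) by (simp add: w_def l_distr m_assoc)
  ultimately show "\<exists>r \<in> carrier R. \<exists>s \<in> carrier R. x \<otimes> r \<oplus> y \<otimes> s = \<one>"
    using st r by (metis m_closed)
qed

text \<open>The idempotent is the \<open>x\<close>-component of \<open>\<one>\<close> in the
  decomposition into \<open>x <# carrier R\<close> and its complement, that is, the projection along
  the complement. Passing from \<open>x\<close> to \<open>x \<otimes> r\<close> enlarges the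
  complement, so the projection of \<open>x \<otimes> r\<close> kills the complement of
  \<open>x\<close>; this is the required identity.\<close>

lemma (in ring) banaschewski_function_imp_idempotents:
  assumes reg: "regular_ring R" and f: "banaschewski_function (principal_right_ideals R) f"
  shows "\<exists>e. banaschewski_idempotents R e"
proof -
  have closed: "\<exists>y \<in> carrier R. f (x <# carrier R) = y <# carrier R" if "x \<in> carrier R" for x
  proof -
    have "f (x <# carrier R) \<in> carrier (principal_right_ideals R)"
      using f that unfolding banaschewski_function_def
      by (auto simp: principal_right_ideals_def elim!: Pi_mem)
    then show ?thesis by (auto simp: principal_right_ideals_def)
  qed
  then obtain g where g: "\<And>x. x \<in> carrier R \<Longrightarrow> g x \<in> carrier R"
    "\<And>x. x \<in> carrier R \<Longrightarrow> f (x <# carrier R) = g x <# carrier R"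
    by metis
  have cap: "(x <# carrier R) \<inter> (g x <# carrier R) = {\<zero>}"
    and "\<exists>r \<in> carrier R. \<exists>s \<in> carrier R. x \<otimes> r \<oplus> g x \<otimes> s = \<one>" if "x \<in> carrier R" for x
    using banaschewski_function_complement[OF reg f that g(1)[OF that] g(2)[OF that]] by auto
  then obtain p q where pq: "\<And>x. x \<in> carrier R \<Longrightarrow> p x \<in> carrier R"
    "\<And>x. x \<in> carrier R \<Longrightarrow> q x \<in> carrier R"
    "\<And>x. x \<in> carrier R \<Longrightarrow> x \<otimes> p x \<oplus> g x \<otimes> q x = \<one>"
    by metis
  have split: "x \<otimes> p x \<otimes> t \<oplus> g x \<otimes> q x \<otimes> t = t" if "x \<in> carrier R" "t \<in> carrier R" for x t
    using pq[of x] g(1)[of x] that by (metis l_distr l_one m_closed)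
  have zeroI: "t = \<zero>"
    if "x \<in> carrier R" "t \<in> x <# carrier R" "t \<in> g x <# carrier R" for x t
    using cap that by blast
  have fix_image: "x \<otimes> p x \<otimes> x = x" if x: "x \<in> carrier R" for x
  proof -
    have c: "p x \<in> carrier R" "q x \<in> carrier R" "g x \<in> carrier R" using x pq g by auto
    have "g x \<otimes> q x \<otimes> x = x \<ominus> x \<otimes> p x \<otimes> x"
      using split[OF x x] c x by (metis add_eq_imp_eq_minus m_closed)
    \<comment> \<open>The left side is visibly in the complement, the right side in the ideal of
      \<open>x\<close>; the two meet only in zero. The same device proves
      \<open>kill\<close>.\<close>
    then have eq: "g x \<otimes> (q x \<otimes> x) = x \<otimes> (\<one> \<ominus> p x \<otimes> x)"
      using c x by (simp add: minus_eq r_distr r_minus m_assoc)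
    have "g x \<otimes> (q x \<otimes> x) = \<zero>"
    proof (rule zeroI[OF x])
      show "g x \<otimes> (q x \<otimes> x) \<in> x <# carrier R"
        unfolding eq using c x by (auto simp: mem_l_coset_carrier)
      show "g x \<otimes> (q x \<otimes> x) \<in> g x <# carrier R"
        using c x by (auto simp: mem_l_coset_carrier)
    qed
    then show ?thesis using split[OF x x] c x by (simp add: m_assoc)
  qed
  have kill: "x \<otimes> p x \<otimes> b = \<zero>" if x: "x \<in> carrier R" and b: "b \<in> g x <# carrier R" for x b
  proof -
    have c: "p x \<in> carrier R" "q x \<in> carrier R" "g x \<in> carrier R" using x pq g by auto
    obtain d where d: "d \<in> carrier R" "b = g x \<otimes> d" using b by (auto simp: mem_l_coset_carrier)
    then have bR: "b \<in> carrier R" using c by simp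
    have "x \<otimes> p x \<otimes> b = b \<ominus> g x \<otimes> q x \<otimes> b"
      using split[OF x bR] c x bR by (metis add_eq_imp_eq_minus a_comm m_closed)
    then have eq: "x \<otimes> (p x \<otimes> b) = g x \<otimes> (d \<ominus> q x \<otimes> b)"
      using c x d bR by (simp add: minus_eq r_distr r_minus m_assoc)
    have "x \<otimes> (p x \<otimes> b) = \<zero>"
    proof (rule zeroI[OF x])
      show "x \<otimes> (p x \<otimes> b) \<in> g x <# carrier R"
        unfolding eq using c x d bR by (auto simp: mem_l_coset_carrier)
      show "x \<otimes> (p x \<otimes> b) \<in> x <# carrier R"
        using c x bR by (auto simp: mem_l_coset_carrier)
    qed
    then show ?thesis using c x bR by (simp add: m_assoc)
  qed
  define e where "e x = x \<otimes> p x" for x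
  have "e (x \<otimes> r) \<otimes> e x = e (x \<otimes> r)" if x: "x \<in> carrier R" and r: "r \<in> carrier R" for x r
  proof -
    have xr: "x \<otimes> r \<in> carrier R" using x r by simp
    have c: "p x \<in> carrier R" "q x \<in> carrier R" "g x \<in> carrier R" "e x \<in> carrier R"
      "e (x \<otimes> r) \<in> carrier R"
      using x xr pq g by (auto simp: e_def)
    have "(x \<otimes> r) <# carrier R \<subseteq> x <# carrier R"
      using x r xr by (auto simp: l_coset_carrier_subset)
    then have "g x <# carrier R \<subseteq> g (x \<otimes> r) <# carrier R"
      using f x xr unfolding banaschewski_function_def g(2)[OF x, symmetric] g(2)[OF xr, symmetric]
      by (simp add: principal_right_ideals_def) blast
    moreover have "g x \<otimes> q x \<in> g x <# carrier R"
      using c by (auto simp: mem_l_coset_carrier)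
    ultimately have "e (x \<otimes> r) \<otimes> (g x \<otimes> q x) = \<zero>"
      unfolding e_def by (intro kill[OF xr]) blast
    moreover have "e (x \<otimes> r) \<otimes> (e x \<oplus> g x \<otimes> q x) = e (x \<otimes> r)"
      unfolding e_def[of x] pq(3)[OF x] using c by simp
    ultimately show ?thesis using c by (simp add: r_distr)
  qed
  then have "banaschewski_idempotents R e"
    unfolding banaschewski_idempotents_def using pq fix_image by (auto simp: e_def)
  then show ?thesis by blast
qed

section \<open>Combinatorics of uncountable sets\<close>

text \<open>A countably infinite \<open>N\<close> and the sets \<open>D i\<close> for
  \<open>i\<close> in \<open>N\<close> cover only countably many points, so some \<open>j\<close> in
  \<open>A\<close> avoids them all; the finite \<open>D j\<close> then misses some \<open>i\<close>
  in \<open>N\<close>. On the naturals, letting \<open>D i\<close> be the numbers up to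
  \<open>i\<close> leaves no such pair, so uncountability is essential.\<close>

lemma uncountable_free_pair:
  fixes D :: "'a \<Rightarrow> 'a set"
  assumes "uncountable A" "\<And>i. i \<in> A \<Longrightarrow> finite (D i)"
  obtains i j where "i \<in> A" "j \<in> A" "i \<noteq> j" "i \<notin> D j" "j \<notin> D i"
proof -
  obtain N where N: "N \<subseteq> A" "countable N" "infinite N"
    using infinite_countable_subset'[of A] assms(1) countable_finite[of A] by metis
  have "countable (\<Union>i\<in>N. insert i (D i))"
    using N assms(2) by (intro countable_UN countable_insert) (auto intro: countable_finite)
  then have "\<not> A \<subseteq> (\<Union>i\<in>N. insert i (D i))"
    using assms(1) countable_subset by metis
  then obtain j where j: "j \<in> A" "j \<notin> (\<Union>i\<in>N. insert i (D i))"
    by blast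
  have "infinite (N - D j)"
    using Diff_infinite_finite[OF assms(2)[OF j(1)] N(3)] .
  then obtain i where "i \<in> N - D j"
    using infinite_imp_nonempty by blast
  then have "i \<in> N" "i \<notin> D j" by auto
  then show ?thesis using j N(1) by (intro that[of i j]) auto
qed

lemma uncountable_fiber:
  assumes "uncountable A" "finite (f ` A)"
  obtains y where "uncountable {x \<in> A. f x = y}"
proof (rule ccontr)
  assume "\<not> thesis"
  then have "countable {x \<in> A. f x = y}" for y using that by blast
  then have "countable (\<Union>y\<in>f ` A. {x \<in> A. f x = y})"
    by (intro countable_UN countable_finite[OF assms(2)])
  also have "(\<Union>y\<in>f ` A. {x \<in> A. f x = y}) = A" by auto
  finally show False using assms(1) by simp
qed

section \<open>The ring of twisted sections\<close>

lemma fun_power_apply: "(f ^ n) x = (f x :: 'b::monoid_mult) ^ n"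
  by (induction n) (simp_all add: one_fun_def times_fun_def)

lemma char_2_double:
  assumes "(1::'k::ring_1) + 1 = 0"
  shows "x + x = (0::'k)"
proof -
  have "x + x = x * (1 + 1)" by (simp only: distrib_left mult_1_right)
  then show ?thesis unfolding assms by simp
qed

text \<open>The diagonal value at (i, i) with i in D is the generic value along row i, and its image
  under the twist is the generic value along column i; l is the value at infinity.\<close>

definition twisted_section :: "('k \<Rightarrow> 'k) \<Rightarrow> 'i set \<Rightarrow> 'k \<Rightarrow> ('i \<times> 'i \<Rightarrow> 'k) \<Rightarrow> 'i \<times> 'i \<Rightarrow> 'k" where
  "twisted_section \<sigma> D l \<theta> = (\<lambda>(i, j).
     if i \<in> D then (if j \<in> D then \<theta> (i, j) else \<theta> (i, i))
     else if j \<in> D then \<sigma> (\<theta> (j, j)) else l)"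

text \<open>By characteristic 2, \<open>{0, 1}\<close> is closed under addition and negation is the
  identity. Since \<sigma> fixes 0 and 1, these can serve as values at infinity that do not change
  when the finite set \<open>D\<close> grows.\<close>

locale twisted_sections =
  fixes \<sigma> :: "'k::ring_1 \<Rightarrow> 'k" and I :: "'i set"
  assumes hom_add: "\<sigma> (x + y) = \<sigma> x + \<sigma> y"
    and hom_mult: "\<sigma> (x * y) = \<sigma> x * \<sigma> y"
    and hom_one: "\<sigma> 1 = 1"
    and char_2: "(1::'k) + 1 = 0"
begin

definition S :: "('i \<times> 'i \<Rightarrow> 'k) set" where
  "S = {twisted_section \<sigma> D l \<theta> | D l \<theta>. finite D \<and> D \<subseteq> I \<and> l \<in> {0, 1}}"

lemma hom_zero: "\<sigma> 0 = 0"
  using hom_add[of 0 0] by simp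

lemma two_eq_0: "(2::'k) = 0"
  using char_2 by simp

lemma minus_eq_self: "- x = (x::'k)"
  using char_2_double[OF char_2] by (rule minus_unique)

lemma twisted_section_in_S: "finite D \<Longrightarrow> D \<subseteq> I \<Longrightarrow> l \<in> {0, 1} \<Longrightarrow> twisted_section \<sigma> D l \<theta> \<in> S"
  unfolding S_def by blast

text \<open>An index of \<open>D'\<close> outside \<open>D\<close> has diagonal value
  \<open>l\<close>, so its row gets \<open>l\<close> and its column gets
  \<open>\<sigma> l = l\<close> outside \<open>D'\<close>, as before.\<close>

lemma twisted_section_extend:
  assumes "D \<subseteq> D'" "l \<in> {0, 1}"
  shows "twisted_section \<sigma> D l \<theta> = twisted_section \<sigma> D' l (twisted_section \<sigma> D l \<theta>)"
proof (rule ext, clarify)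
  fix i j
  have "\<sigma> l = l" using assms(2) hom_zero hom_one by auto
  then show "twisted_section \<sigma> D l \<theta> (i, j) = twisted_section \<sigma> D' l (twisted_section \<sigma> D l \<theta>) (i, j)"
    using subsetD[OF assms(1), of i] subsetD[OF assms(1), of j] by (simp add: twisted_section_def)
qed

text \<open>A member of \<open>S\<close> serves as its own data over every larger finite set. Hence
  two members can be written over a common \<open>D\<close>, where the operations are
  pointwise.\<close>

lemma S_extend:
  assumes "\<phi> \<in> S"
  obtains D l where "finite D" "D \<subseteq> I" "l \<in> {0, 1}"
    "\<And>D'. D \<subseteq> D' \<Longrightarrow> twisted_section \<sigma> D' l \<phi> = \<phi>"
proof -
  obtain D l \<theta> where D: "finite D" "D \<subseteq> I" "l \<in> {0, 1}" "\<phi> = twisted_section \<sigma> D l \<theta>"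
    using assms unfolding S_def by blast
  show ?thesis
    by (rule that[OF D(1-3)]) (simp only: D(4) twisted_section_extend[OF _ D(3), symmetric])
qed

lemma S_common:
  assumes "\<phi> \<in> S" "\<psi> \<in> S"
  obtains D l m where "finite D" "D \<subseteq> I" "l \<in> {0, 1}" "m \<in> {0, 1}"
    "twisted_section \<sigma> D l \<phi> = \<phi>" "twisted_section \<sigma> D m \<psi> = \<psi>"
proof -
  obtain D l where D: "finite D" "D \<subseteq> I" "l \<in> {0, 1}" "\<And>D'. D \<subseteq> D' \<Longrightarrow> twisted_section \<sigma> D' l \<phi> = \<phi>"
    using S_extend[OF assms(1)] by metis
  obtain D2 m where D2: "finite D2" "D2 \<subseteq> I" "m \<in> {0, 1}" "\<And>D'. D2 \<subseteq> D' \<Longrightarrow> twisted_section \<sigma> D' m \<psi> = \<psi>"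
    using S_extend[OF assms(2)] by metis
  show ?thesis using D D2 by (intro that[of "D \<union> D2" l m]) auto
qed

lemma twisted_section_add: "twisted_section \<sigma> D l \<theta> + twisted_section \<sigma> D m \<eta> = twisted_section \<sigma> D (l + m) (\<theta> + \<eta>)"
  by (auto simp: twisted_section_def fun_eq_iff hom_add)

lemma twisted_section_mult: "twisted_section \<sigma> D l \<theta> * twisted_section \<sigma> D m \<eta> = twisted_section \<sigma> D (l * m) (\<theta> * \<eta>)"
  by (auto simp: twisted_section_def fun_eq_iff hom_mult)

lemma twisted_section_const: "l \<in> {0, 1} \<Longrightarrow> twisted_section \<sigma> D l (\<lambda>_. l) = (\<lambda>_. l)"
  by (auto simp: twisted_section_def fun_eq_iff hom_zero hom_one)

lemma const_in_S: assumes "l \<in> {0, 1}" shows "(\<lambda>_. l) \<in> S"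
proof -
  have "twisted_section \<sigma> {} l (\<lambda>_. l) \<in> S" using assms by (intro twisted_section_in_S) auto
  then show ?thesis by (simp only: twisted_section_const[OF assms])
qed

lemma S_zero: "0 \<in> S"
  unfolding zero_fun_def by (rule const_in_S) simp

lemma S_one: "1 \<in> S"
  unfolding one_fun_def by (rule const_in_S) simp

lemma S_add: assumes "\<phi> \<in> S" "\<psi> \<in> S" shows "\<phi> + \<psi> \<in> S"
proof -
  obtain D l m where D: "finite D" "D \<subseteq> I" "l \<in> {0, 1}" "m \<in> {0, 1}"
    "twisted_section \<sigma> D l \<phi> = \<phi>" "twisted_section \<sigma> D m \<psi> = \<psi>"
    using S_common[OF assms] .
  have "l + m \<in> {0, 1}" using D(3,4) by (auto simp: two_eq_0)
  then have "twisted_section \<sigma> D l \<phi> + twisted_section \<sigma> D m \<psi> \<in> S"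
    unfolding twisted_section_add by (rule twisted_section_in_S[OF D(1,2)])
  then show ?thesis by (simp only: D(5,6))
qed

lemma S_mult: assumes "\<phi> \<in> S" "\<psi> \<in> S" shows "\<phi> * \<psi> \<in> S"
proof -
  obtain D l m where D: "finite D" "D \<subseteq> I" "l \<in> {0, 1}" "m \<in> {0, 1}"
    "twisted_section \<sigma> D l \<phi> = \<phi>" "twisted_section \<sigma> D m \<psi> = \<psi>"
    using S_common[OF assms] .
  have "l * m \<in> {0, 1}" using D(3,4) by (auto simp: two_eq_0)
  then have "twisted_section \<sigma> D l \<phi> * twisted_section \<sigma> D m \<psi> \<in> S"
    unfolding twisted_section_mult by (rule twisted_section_in_S[OF D(1,2)])
  then show ?thesis by (simp only: D(5,6))
qed

lemma S_uminus: "\<phi> \<in> S \<Longrightarrow> - \<phi> \<in> S"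
  by (simp add: fun_Compl_def minus_eq_self)

lemma S_unit_regular:
  assumes K: "\<And>x::'k. \<exists>u v. u * v = 1 \<and> v * u = 1 \<and> x * u * x = x" and \<phi>: "\<phi> \<in> S"
  shows "\<exists>u\<in>S. \<exists>v\<in>S. u * v = 1 \<and> v * u = 1 \<and> \<phi> * u * \<phi> = \<phi>"
proof -
  obtain p q where pq: "\<And>x::'k. p x * q x = 1" "\<And>x. q x * p x = 1" "\<And>x. x * p x * x = x"
    using K by metis
  obtain D l where D: "finite D" "D \<subseteq> I" "l \<in> {0, 1}" "twisted_section \<sigma> D l \<phi> = \<phi>"
    using S_common[OF \<phi> \<phi>] by metis
  \<comment> \<open>The value at infinity is 1, which is invertible and satisfies
    \<open>l * 1 * l = l\<close>. On twisted columns \<open>u\<close> is the image under \<sigma> of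
    the diagonal choice, not \<open>p\<close> of the value there; the identities carry over because
    \<sigma> is a homomorphism.\<close>
  define u v where "u = twisted_section \<sigma> D 1 (p \<circ> \<phi>)" "v = twisted_section \<sigma> D 1 (q \<circ> \<phi>)"
  have "u \<in> S" "v \<in> S" using D by (auto simp: u_v_def intro!: twisted_section_in_S)
  moreover have "(p \<circ> \<phi>) * (q \<circ> \<phi>) = 1" "(q \<circ> \<phi>) * (p \<circ> \<phi>) = 1" "\<phi> * (p \<circ> \<phi>) * \<phi> = \<phi>"
    by (auto simp: fun_eq_iff pq)
  then have "u * v = 1" "v * u = 1" "twisted_section \<sigma> D l \<phi> * u * twisted_section \<sigma> D l \<phi> = twisted_section \<sigma> D l \<phi>"
    using D(3) twisted_section_const[of 1 D] by (auto simp: u_v_def twisted_section_mult one_fun_def)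
  ultimately show ?thesis using D(4) by auto
qed

text \<open>The two equations on \<open>E\<close> say that \<open>E\<close> and
  \<open>\<sigma> E\<close> generate the same right ideal; \<open>not_fixed\<close> says that
  \<sigma> fixes no idempotent generator of it. Comparing two suitable indices would produce such a
  generator.\<close>

lemma S_no_idempotent_choice:
  assumes I: "uncountable I" and K: "finite (UNIV :: 'k set)"
    and E: "\<sigma> E = E * s" "\<sigma> E * w = E" and not_fixed: "\<And>c t. c * E = E \<Longrightarrow> c = E * t \<Longrightarrow> \<sigma> c \<noteq> c"
    and e: "\<And>\<phi>. \<phi> \<in> S \<Longrightarrow> e \<phi> \<in> S" "\<And>\<phi>. \<phi> \<in> S \<Longrightarrow> e \<phi> * \<phi> = \<phi>"
      "\<And>\<phi>. \<phi> \<in> S \<Longrightarrow> \<exists>\<rho>\<in>S. e \<phi> = \<phi> * \<rho>"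
      "\<And>\<phi> \<rho>. \<phi> \<in> S \<Longrightarrow> \<rho> \<in> S \<Longrightarrow> e (\<phi> * \<rho>) * e \<phi> = e (\<phi> * \<rho>)"
  shows False
proof -
  define bump where "bump i = twisted_section \<sigma> {i} 0 (\<lambda>_. E)" for i :: 'i
  have bump: "bump i \<in> S" if "i \<in> I" for i
    unfolding bump_def using that by (intro twisted_section_in_S) auto
  have e_at: "e \<phi> p * \<phi> p = \<phi> p" "\<exists>t. e \<phi> p = \<phi> p * t" if \<phi>: "\<phi> \<in> S" for \<phi> p
  proof -
    show "e \<phi> p * \<phi> p = \<phi> p"
      using fun_cong[OF e(2)[OF \<phi>], of p] by simp
    obtain \<rho> where "e \<phi> = \<phi> * \<rho>" using e(3)[OF \<phi>] by blast
    then show "\<exists>t. e \<phi> p = \<phi> p * t" by auto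
  qed
  \<comment> \<open>At \<open>p\<close> the elements \<open>\<phi>\<close> and
    \<open>\<phi> * \<rho>\<close> both generate the right ideal of \<open>E\<close>. There
    \<open>e (\<phi> * \<rho>) p\<close> is a left identity, so it fixes \<open>e \<phi> p\<close>;
    the antitonicity identity evaluates the same product as
    \<open>e (\<phi> * \<rho>) p\<close>.\<close>
  have restrict: "e (\<phi> * \<rho>) p = e \<phi> p"
    if \<phi>\<rho>: "\<phi> \<in> S" "\<rho> \<in> S" "\<phi> p * \<rho> p = E" "\<phi> p = E * r" for \<phi> \<rho> p r
  proof -
    have q: "e (\<phi> * \<rho>) p * E = E" using e_at(1)[OF S_mult[OF \<phi>\<rho>(1,2)], of p] \<phi>\<rho>(3) by simp
    obtain t where t: "e \<phi> p = \<phi> p * t" using e_at(2)[OF \<phi>\<rho>(1)] by blast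
    have "e (\<phi> * \<rho>) p * e \<phi> p = e (\<phi> * \<rho>) p"
      using fun_cong[OF e(4)[OF \<phi>\<rho>(1,2)], of p] by simp
    moreover have "e (\<phi> * \<rho>) p * e \<phi> p = e \<phi> p"
      unfolding t \<phi>\<rho>(4) using q by (simp flip: mult.assoc)
    ultimately show ?thesis by simp
  qed
  \<comment> \<open>Demanding \<open>i \<in> D\<close> ensures that outside \<open>D\<close> the row
    and column of \<open>i\<close> are determined by the diagonal value at
    \<open>(i, i)\<close>.\<close>
  define supports where "supports D i \<longleftrightarrow>
    finite D \<and> i \<in> D \<and> (\<exists>l. twisted_section \<sigma> D l (e (bump i)) = e (bump i))" for D i
  have "\<exists>D. supports D i" if i: "i \<in> I" for i
  proof -
    obtain D l where D: "finite D" "\<And>D'. D \<subseteq> D' \<Longrightarrow> twisted_section \<sigma> D' l (e (bump i)) = e (bump i)"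
      using S_extend[OF e(1)[OF bump[OF i]]] by metis
    then have "supports (insert i D) i"
      using D(2)[OF subset_insertI] unfolding supports_def by blast
    then show ?thesis ..
  qed
  then obtain D where D: "\<And>i. i \<in> I \<Longrightarrow> supports (D i) i"
    by metis
  define c where "c i = e (bump i) (i, i)" for i
  have "finite (c ` I)" using finite_subset[OF subset_UNIV K] .
  then obtain k where k: "uncountable {i \<in> I. c i = k}"
    by (rule uncountable_fiber[OF I])
  obtain i j where ij: "i \<in> I" "c i = k" "j \<in> I" "c j = k" "i \<noteq> j" "i \<notin> D j" "j \<notin> D i"
    by (rule uncountable_free_pair[OF k, of D]) (use D in \<open>auto simp: supports_def\<close>)
  \<comment> \<open>\<open>P a\<close> vanishes except at \<open>(i, j)\<close>, where it is
    \<open>a\<close>; multiplying by it isolates the one point at which row \<open>i\<close> meets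
    column \<open>j\<close>.\<close>
  define P where "P a = twisted_section \<sigma> {i, j} 0 (\<lambda>p. if p = (i, j) then a else 0)" for a
  have P: "P a \<in> S" "P a (i, j) = a" for a
  proof -
    show "P a \<in> S" unfolding P_def using ij by (intro twisted_section_in_S) auto
    show "P a (i, j) = a" by (simp add: P_def twisted_section_def)
  qed
  have bump_at: "bump i (i, j) = E" "bump j (i, j) = E * s"
    using ij(5) by (auto simp: bump_def twisted_section_def E(1))
  \<comment> \<open>At \<open>(i, j)\<close> the factors are \<open>E * 1\<close> and
    \<open>\<sigma> E * w\<close>, both equal to \<open>E\<close>.\<close>
  have bump_P: "bump i * P 1 = bump j * P w"
    using ij(5) E(2) by (auto simp: bump_def P_def twisted_section_def fun_eq_iff hom_zero)
  have "e (bump i) (i, j) = e (bump i * P 1) (i, j)"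
    by (rule restrict[of _ _ _ 1, symmetric]) (use bump P bump_at ij in auto)
  also have "\<dots> = e (bump j) (i, j)"
    unfolding bump_P by (rule restrict[of _ _ _ s]) (use bump P bump_at E ij in auto)
  \<comment> \<open>Since \<open>i\<close> is outside \<open>D j\<close>, the point
    \<open>(i, j)\<close> lies in the twisted column of \<open>j\<close>. Below, \<open>j\<close>
    outside \<open>D i\<close> places the same point in the untwisted row of
    \<open>i\<close>.\<close>
  also have "\<dots> = \<sigma> (c j)"
  proof -
    obtain m where "j \<in> D j" "twisted_section \<sigma> (D j) m (e (bump j)) = e (bump j)"
      using D[OF ij(3)] unfolding supports_def by blast
    then show ?thesis
      using ij(6) by (auto simp: twisted_section_def c_def dest: fun_cong[of _ _ "(i, j)"])
  qed
  finally have "\<sigma> k = e (bump i) (i, j)" using ij(4) by simp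
  also have "\<dots> = k"
  proof -
    obtain m where "i \<in> D i" "twisted_section \<sigma> (D i) m (e (bump i)) = e (bump i)"
      using D[OF ij(1)] unfolding supports_def by blast
    then show ?thesis
      using ij(2,7) by (auto simp: twisted_section_def c_def dest: fun_cong[of _ _ "(i, j)"])
  qed
  finally have "\<sigma> k = k" .
  moreover have "bump i (i, i) = E" by (simp add: bump_def twisted_section_def)
  then have "k * E = E" "\<exists>t. k = E * t"
    using e_at[OF bump[OF ij(1)], of "(i, i)"] ij(2) unfolding c_def by auto
  ultimately show False using not_fixed by blast
qed

text \<open>A section is coded by a truth value for \<open>l\<close> and the finite graph of its
  values on \<open>D \<times> D\<close>, and an infinite set has no more finite subsets than
  elements. Conversely, the sections with value 1 along a single row are distinct.\<close>

lemma S_card: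
  assumes I: "infinite I" and K: "finite (UNIV :: 'k set)"
  shows "|S| =o |I|"
proof -
  define f :: "bool \<times> ('i \<times> 'i \<times> 'k) set \<Rightarrow> _" where
    "f = (\<lambda>(b, G). twisted_section \<sigma> (fst ` G) (of_bool b) (\<lambda>(i, j). THE k. (i, j, k) \<in> G))"
  let ?A = "(UNIV :: bool set) \<times> Fpow (I \<times> I \<times> (UNIV :: 'k set))"
  have "S \<subseteq> f ` ?A"
  proof
    fix \<phi> assume "\<phi> \<in> S"
    then obtain D l where D: "finite D" "D \<subseteq> I" "l \<in> {0, 1}" "twisted_section \<sigma> D l \<phi> = \<phi>"
      using S_common by metis
    define G where "G = (\<lambda>(i, j). (i, j, \<phi> (i, j))) ` (D \<times> D)"
    have "fst ` G = D" by (force simp: G_def)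
    moreover have "(THE k. (i, j, k) \<in> G) = \<phi> (i, j)" if "i \<in> D" "j \<in> D" for i j
      using that by (auto simp: G_def)
    ultimately have "f (l = 1, G) = twisted_section \<sigma> D l \<phi>"
      using D(3) by (auto simp: f_def twisted_section_def fun_eq_iff)
    moreover have "G \<in> Fpow (I \<times> I \<times> UNIV)"
      using D(1,2) by (auto simp: Fpow_def G_def)
    ultimately show "\<phi> \<in> f ` ?A" using D(4) by (intro image_eqI[of _ _ "(l = 1, G)"]) auto
  qed
  then have "|S| \<le>o |?A|" using surj_imp_ordLeq by blast
  also have "|?A| \<le>o |I|"
  proof -
    have fin: "|B| \<le>o |I|" if "finite B" for B :: "'c set"
      using I that by (simp add: ordLess_imp_ordLeq finite_ordLess_infinite2)
    have "|I \<times> I \<times> (UNIV :: 'k set)| \<le>o |I|"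
      using I fin[OF K] by (intro card_of_Times_ordLeq_infinite) auto
    moreover have "infinite (I \<times> I \<times> (UNIV :: 'k set))"
      using I by (metis UNIV_not_empty finite_cartesian_productD1 Sigma_empty_iff finite.emptyI)
    ultimately have "|Fpow (I \<times> I \<times> (UNIV :: 'k set))| \<le>o |I|"
      using card_of_Fpow_infinite ordIso_ordLeq_trans by blast
    then show ?thesis
      using card_of_Times_ordLeq_infinite[OF I fin[OF finite]] by blast
  qed
  finally have "|S| \<le>o |I|" .
  moreover have "|I| \<le>o |S|"
  proof -
    define bump :: "'i \<Rightarrow> 'i \<times> 'i \<Rightarrow> 'k" where "bump i = twisted_section \<sigma> {i} 0 (\<lambda>_. 1)" for i
    have "inj_on bump I"
    proof (rule inj_onI)
      fix i j assume "bump i = bump j"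
      then have "bump i (i, i) = bump j (i, i)" by simp
      then show "i = j" by (simp add: bump_def twisted_section_def split: if_splits)
    qed
    moreover have "bump ` I \<subseteq> S" unfolding bump_def by (intro image_subsetI twisted_section_in_S) auto
    ultimately show ?thesis using card_of_ordLeq by blast
  qed
  ultimately show ?thesis by (simp add: ordIso_iff_ordLeq)
qed

end

section \<open>Transfer to a ring with an explicit carrier\<close>

text \<open>Moves the construction to the element type required of the carrier.\<close>

definition copy_ring :: "('a::ring_1 \<Rightarrow> 'b) \<Rightarrow> 'a set \<Rightarrow> 'b ring" where
  "copy_ring h S = \<lparr>carrier = h ` S,
     monoid.mult = (\<lambda>x y. h (inv_into S h x * inv_into S h y)), one = h 1,
     ring.zero = h 0, ring.add = (\<lambda>x y. h (inv_into S h x + inv_into S h y))\<rparr>"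

locale subring_copy =
  fixes h :: "'a::ring_1 \<Rightarrow> 'b" and S :: "'a set"
  assumes inj: "inj_on h S"
    and zero_mem: "0 \<in> S" and one_mem: "1 \<in> S"
    and add_mem: "a \<in> S \<Longrightarrow> b \<in> S \<Longrightarrow> a + b \<in> S"
    and mult_mem: "a \<in> S \<Longrightarrow> b \<in> S \<Longrightarrow> a * b \<in> S"
    and uminus_mem: "a \<in> S \<Longrightarrow> - a \<in> S"
begin

abbreviation "C \<equiv> copy_ring h S"

lemma carrier_copy: "carrier C = h ` S"
  by (simp add: copy_ring_def)

lemma zero_copy: "\<zero>\<^bsub>C\<^esub> = h 0" and one_copy: "\<one>\<^bsub>C\<^esub> = h 1"
  by (simp_all add: copy_ring_def)

lemma add_copy: "a \<in> S \<Longrightarrow> b \<in> S \<Longrightarrow> h a \<oplus>\<^bsub>C\<^esub> h b = h (a + b)"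
  and mult_copy: "a \<in> S \<Longrightarrow> b \<in> S \<Longrightarrow> h a \<otimes>\<^bsub>C\<^esub> h b = h (a * b)"
  by (simp_all add: copy_ring_def inj)

lemmas copy_simps = carrier_copy zero_copy one_copy add_copy mult_copy
lemmas mem_simps = zero_mem one_mem add_mem mult_mem uminus_mem

lemma h_eq_iff: "a \<in> S \<Longrightarrow> b \<in> S \<Longrightarrow> h a = h b \<longleftrightarrow> a = b"
  using inj by (simp add: inj_on_eq_iff)

lemma ring_copy: "ring C"
proof (rule ringI)
  show "abelian_group C"
  proof (rule abelian_groupI)
    fix x assume "x \<in> carrier C"
    then obtain a where a: "a \<in> S" "x = h a" by (auto simp: carrier_copy)
    then show "\<exists>y\<in>carrier C. y \<oplus>\<^bsub>C\<^esub> x = \<zero>\<^bsub>C\<^esub>"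
      by (intro bexI[of _ "h (- a)"]) (simp_all add: copy_simps mem_simps)
  qed (auto simp: copy_simps mem_simps add_ac)
  show "monoid C"
    by (rule monoidI) (auto simp: copy_simps mem_simps mult.assoc)
qed (auto simp: copy_simps mem_simps distrib_left distrib_right)

lemma power_copy: "a \<in> S \<Longrightarrow> a ^ n \<in> S \<and> h a [^]\<^bsub>C\<^esub> (n::nat) = h (a ^ n)"
  by (induction n) (simp_all add: copy_simps mem_simps power_Suc2 del: power_Suc)

lemma unit_regular_copy:
  assumes "\<And>a. a \<in> S \<Longrightarrow> \<exists>u\<in>S. \<exists>v\<in>S. u * v = 1 \<and> v * u = 1 \<and> a * u * a = a"
  shows "unit_regular_ring C"
  unfolding unit_regular_ring_def
proof (intro conjI ballI ring_copy)
  fix x assume "x \<in> carrier C"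
  then obtain a where a: "a \<in> S" "x = h a" by (auto simp: carrier_copy)
  obtain u v where uv: "u \<in> S" "v \<in> S" "u * v = 1" "v * u = 1" "a * u * a = a"
    using assms[OF a(1)] by blast
  have "h u \<in> Units C"
    using uv unfolding Units_def by (auto simp: copy_simps intro!: bexI[of _ v])
  moreover have "x \<otimes>\<^bsub>C\<^esub> h u \<otimes>\<^bsub>C\<^esub> x = x"
    using a uv by (simp add: copy_simps mem_simps)
  ultimately show "\<exists>u\<in>Units C. x \<otimes>\<^bsub>C\<^esub> u \<otimes>\<^bsub>C\<^esub> x = x" by blast
qed

lemma nilpotence_index_copy:
  assumes bound: "\<And>a n. a \<in> S \<Longrightarrow> a ^ n = 0 \<Longrightarrow> a ^ Suc k = 0"
    and a: "a \<in> S" "a ^ Suc k = 0" "a ^ k \<noteq> 0"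
  shows "nilpotence_index C = enat (Suc k)"
proof -
  have pow_iff: "h b [^]\<^bsub>C\<^esub> (n::nat) = \<zero>\<^bsub>C\<^esub> \<longleftrightarrow> b ^ n = 0" if "b \<in> S" for b n
    using power_copy[OF that, of n] by (simp add: zero_copy h_eq_iff zero_mem)
  have "element_nilpotence_index C x \<le> Suc k" if nil: "x \<in> nilpotent_elements C" for x
  proof -
    obtain b n where b: "b \<in> S" "x = h b" "x [^]\<^bsub>C\<^esub> (n::nat) = \<zero>\<^bsub>C\<^esub>"
      using nil by (auto simp: nilpotent_elements_def carrier_copy)
    then have "b ^ Suc k = 0" using bound[OF b(1)] pow_iff[OF b(1)] by blast
    then show ?thesis
      unfolding element_nilpotence_index_def b(2)
      by (intro Least_le) (simp add: pow_iff[OF b(1)] del: power_Suc nat_pow_Suc)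
  qed
  moreover have "h a \<in> nilpotent_elements C"
    using a(1,2) pow_iff[OF a(1)] unfolding nilpotent_elements_def carrier_copy by blast
  moreover have "element_nilpotence_index C (h a) = Suc k"
    unfolding element_nilpotence_index_def pow_iff[OF a(1)]
  proof (rule Least_equality)
    fix n assume n: "0 < n \<and> a ^ n = 0"
    show "Suc k \<le> n"
    proof (rule ccontr)
      assume "\<not> Suc k \<le> n"
      then have "a ^ k = a ^ n * a ^ (k - n)" by (simp flip: power_add)
      with n a(3) show False by simp
    qed
  qed (use a(2) in simp)
  ultimately show ?thesis
    unfolding nilpotence_index_def
    by (intro antisym SUP_least) (auto intro!: SUP_upper2[of "h a"])
qed

text \<open>Pulling the choice back along \<open>h\<close> restates its equations with class
  operations, so that for a ring of functions they can be evaluated pointwise.\<close>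

lemma banaschewski_idempotents_copy:
  assumes "banaschewski_idempotents C f"
  obtains e where "\<And>a. a \<in> S \<Longrightarrow> e a \<in> S" "\<And>a. a \<in> S \<Longrightarrow> e a * a = a"
    "\<And>a. a \<in> S \<Longrightarrow> \<exists>r\<in>S. e a = a * r"
    "\<And>a r. a \<in> S \<Longrightarrow> r \<in> S \<Longrightarrow> e (a * r) * e a = e (a * r)"
proof -
  define e where "e a = inv_into S h (f (h a))" for a
  have f: "f (h a) \<in> h ` S" "f (h a) \<otimes>\<^bsub>C\<^esub> h a = h a" "\<exists>r\<in>S. f (h a) = h a \<otimes>\<^bsub>C\<^esub> h r" if "a \<in> S" for a
    using assms that unfolding banaschewski_idempotents_def carrier_copy by blast+
  have f4: "f (h a \<otimes>\<^bsub>C\<^esub> h r) \<otimes>\<^bsub>C\<^esub> f (h a) = f (h a \<otimes>\<^bsub>C\<^esub> h r)" if "a \<in> S" "r \<in> S" for a r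
    using assms that unfolding banaschewski_idempotents_def carrier_copy by blast
  have e: "e a \<in> S" "h (e a) = f (h a)" if "a \<in> S" for a
    using f(1)[OF that] by (auto simp: e_def inv_into_into f_inv_into_f)
  show ?thesis
  proof (rule that[of e])
    fix a assume a: "a \<in> S"
    show "e a \<in> S" using e(1)[OF a] .
    have "h (e a * a) = h a"
      using f(2)[OF a] a by (simp add: mult_copy e flip: e(2))
    then show "e a * a = a" using a e(1)[OF a] by (simp add: h_eq_iff mem_simps)
    obtain r where r: "r \<in> S" "f (h a) = h a \<otimes>\<^bsub>C\<^esub> h r" using f(3)[OF a] by blast
    then have "h (e a) = h (a * r)" using a by (simp add: e mult_copy)
    then show "\<exists>r\<in>S. e a = a * r" using r(1) a e(1)[OF a] by (auto simp: h_eq_iff mem_simps)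
  next
    fix a r assume a: "a \<in> S" and r: "r \<in> S"
    have "h (e (a * r) * e a) = h (e (a * r))"
      using f4[OF a r] a r by (simp add: mult_copy e(1) mem_simps flip: e(2))
    then show "e (a * r) * e a = e (a * r)" using a r by (simp add: h_eq_iff e(1) mem_simps)
  qed
qed

end

section \<open>Conjugation by an involution and the final ring\<close>

text \<open>Characteristic 2 and \<open>n * n = 0\<close> make \<open>1 + n\<close> its own inverse,
  so the map is conjugation by a unit.\<close>

lemma twisted_sections_conj:
  assumes "(1::'k::ring_1) + 1 = 0" "n * n = (0::'k)"
  shows "twisted_sections (\<lambda>c. (1 + n) * c * (1 + n))"
proof
  have two: "n + n = 0"
    using char_2_double[OF assms(1)] .
  have sq: "(1 + n) * (1 + n) = 1"
    using two assms(2) by (simp add: distrib_left distrib_right add.assoc)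
  show "(1 + n) * (x * y) * (1 + n) = (1 + n) * x * (1 + n) * ((1 + n) * y * (1 + n))" for x y
    using sq by (simp add: mult.assoc) (metis mult.assoc mult_1_left)
  show "(1 + n) * 1 * (1 + n) = 1" using sq by simp
qed (use assms(1) in \<open>simp_all add: distrib_left distrib_right\<close>)

text \<open>Since \<open>c\<close> and \<open>x\<close> generate the same right ideal,
  \<open>n * c = 0\<close> and \<open>c * n = n\<close>, so the conjugate of \<open>c\<close> is
  \<open>c + n\<close>.\<close>

lemma conj_not_fixed:
  fixes n c x t :: "'k::ring_1"
  assumes two: "(1::'k) + 1 = 0"
    and "x * n = n" "n * x = 0" "n \<noteq> 0" "c * x = x" "c = x * t"
  shows "(1 + n) * c * (1 + n) \<noteq> c"
proof
  have "n * c = 0" using assms by (simp flip: mult.assoc)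
  moreover have "c * n = n" using assms by (metis mult.assoc)
  moreover assume "(1 + n) * c * (1 + n) = c"
  ultimately show False using \<open>n \<noteq> 0\<close> by (simp add: distrib_left distrib_right)
qed

theorem mainTheorem2:
  shows "\<exists>R :: nat set ring.
           unit_regular_ring R \<and>
           has_cardinality_aleph1 (carrier R) \<and>
           nilpotence_index R = 3 \<and>
           \<not> (\<exists>f. banaschewski_function (principal_right_ideals R) f)"
proof -
  \<comment> \<open>The field of \<open>cardSuc natLeq\<close> consists of sets of naturals and has
    cardinality aleph_1.\<close>
  define I :: "nat set set" where "I = Field (cardSuc natLeq)"
  have I_card: "|I| =o cardSuc natLeq"
    unfolding I_def by (intro card_of_Field_ordIso cardSuc_Card_order natLeq_Card_order)
  have I_unc: "uncountable I"
  proof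
    assume "countable I"
    then have "|I| \<le>o natLeq" by (simp add: countable_card_le_natLeq)
    then have "cardSuc natLeq \<le>o natLeq"
      using I_card ordIso_ordLeq_trans ordIso_symmetric by blast
    then show False
      using cardSuc_greater[OF natLeq_Card_order] not_ordLess_ordLeq by blast
  qed
  define N E :: "(bit, 3) square_matrix" where "N = matrix_unit 1 2" and "E = matrix_unit 1 1"
  have NE: "N * N = 0" "E * N = N" "N * E = 0" "N \<noteq> 0"
    by (simp_all add: N_def E_def matrix_unit_mult matrix_unit_nonzero)
  define \<sigma> where "\<sigma> c = (1 + N) * c * (1 + N)" for c
  interpret twisted_sections \<sigma> I
    unfolding \<sigma>_def by (rule twisted_sections_conj[OF square_matrix_bit_char_2 NE(1)])
  have S_card_aleph1: "|S| =o cardSuc natLeq"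
    using S_card[OF uncountable_infinite[OF I_unc] finite_square_matrix] I_card ordIso_transitive
    by blast
  \<comment> \<open>Cantor's theorem suffices here, because \<open>cardSuc natLeq\<close> is the
    least cardinal above \<open>natLeq\<close>.\<close>
  have "natLeq <o |UNIV :: nat set set|"
    using card_of_nat card_of_set_type ordIso_symmetric ordIso_ordLess_trans by blast
  then have "cardSuc natLeq \<le>o |UNIV :: nat set set|"
    by (intro cardSuc_least natLeq_Card_order card_of_Card_order)
  then have "|S| \<le>o |UNIV :: nat set set|"
    using S_card_aleph1 ordIso_ordLeq_trans by blast
  then obtain h :: "_ \<Rightarrow> nat set" where h: "inj_on h S"
    unfolding card_of_ordLeq[symmetric] by blast
  interpret subring_copy h S
    using h S_zero S_one S_add S_mult S_uminus by unfold_locales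
  have unit_reg: "unit_regular_ring C"
    by (intro unit_regular_copy S_unit_regular) (metis square_matrix_unit_regular)
  moreover have "has_cardinality_aleph1 (carrier C)"
  proof -
    have "|S| =o |h ` S|" using h card_of_ordIso bij_betw_imageI by blast
    then show ?thesis
      unfolding has_cardinality_aleph1_def carrier_copy
      using S_card_aleph1 ordIso_transitive ordIso_symmetric by blast
  qed
  moreover have "nilpotence_index C = enat (Suc 2)"
  proof -
    \<comment> \<open>A nilpotent Jordan block of size 3, placed on a row to attain index 3. In the
      index type \<open>3\<close> the numeral 3 equals 0, so 1, 2 and 3 are distinct
      indices.\<close>
    define J :: "(bit, 3) square_matrix" where "J = matrix_unit 1 2 + matrix_unit 2 3"
    have JJ: "J * J = matrix_unit 1 3" and JJJ: "J * J * J = 0"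
      by (simp_all add: J_def distrib_left distrib_right matrix_unit_mult)
    obtain i where i: "i \<in> I" using I_unc by fastforce
    define \<phi> where "\<phi> = twisted_section \<sigma> {i} 0 (\<lambda>_. J)"
    have "\<phi> \<in> S" unfolding \<phi>_def using i by (intro twisted_section_in_S) auto
    moreover have "\<phi> * \<phi> * \<phi> = twisted_section \<sigma> {i} 0 (\<lambda>_. 0)"
      unfolding \<phi>_def twisted_section_mult by (simp add: times_fun_def JJJ)
    then have "\<phi> * \<phi> * \<phi> = 0"
      by (simp add: twisted_section_const zero_fun_def)
    then have "\<phi> ^ Suc 2 = 0"
      by (simp add: eval_nat_numeral mult.assoc)
    moreover have "(\<phi> ^ 2) (i, i) = matrix_unit 1 3"
      by (simp add: power2_eq_square \<phi>_def twisted_section_def JJ)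
    then have "\<phi> ^ 2 \<noteq> 0" using matrix_unit_nonzero by (metis zero_fun_def)
    \<comment> \<open>Powers are taken pointwise, so the bound for matrices of size 3 applies at
      every point.\<close>
    moreover have "\<psi> ^ Suc 2 = 0" if "\<psi> ^ n = 0"
      for \<psi> :: "nat set \<times> nat set \<Rightarrow> (bit, 3) square_matrix" and n
    proof -
      have "\<psi> p ^ CARD(3) = 0" for p
        using that by (intro square_matrix_nilpotent[of _ n]) (simp flip: fun_power_apply)
      then show ?thesis by (simp add: fun_eq_iff fun_power_apply eval_nat_numeral)
    qed
    ultimately show ?thesis by (intro nilpotence_index_copy) blast+
  qed
  then have "nilpotence_index C = 3" by (simp add: numeral_eq_enat)
  moreover have "\<not> (\<exists>f. banaschewski_function (principal_right_ideals C) f)"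
  proof
    assume "\<exists>f. banaschewski_function (principal_right_ideals C) f"
    then obtain f where f: "banaschewski_idempotents C f"
      using ring.banaschewski_function_imp_idempotents[OF ring_copy unit_regular_imp_regular[OF unit_reg]]
      by blast
    show False
    proof (rule banaschewski_idempotents_copy[OF f])
      fix e
      assume e: "\<And>a. a \<in> S \<Longrightarrow> e a \<in> S" "\<And>a. a \<in> S \<Longrightarrow> e a * a = a"
        "\<And>a. a \<in> S \<Longrightarrow> \<exists>r\<in>S. e a = a * r"
        "\<And>a r. a \<in> S \<Longrightarrow> r \<in> S \<Longrightarrow> e (a * r) * e a = e (a * r)"
      show False
      proof (rule S_no_idempotent_choice[OF I_unc finite_square_matrix _ _ _ e])
        \<comment> \<open>As \<open>N * E = 0\<close>, conjugation only multiplies \<open>E\<close>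
          on the right by the involution \<open>1 + N\<close>, which therefore serves as both
          \<open>s\<close> and \<open>w\<close>.\<close>
        show "\<sigma> E = E * (1 + N)" "\<sigma> E * (1 + N) = E"
          using NE char_2_double[OF square_matrix_bit_char_2, of N] unfolding \<sigma>_def
          by (simp_all add: distrib_left distrib_right)
        show "\<sigma> c \<noteq> c" if "c * E = E" "c = E * t" for c t
          unfolding \<sigma>_def
          by (rule conj_not_fixed[OF square_matrix_bit_char_2 NE(2-4) that])
      qed
    qed
  qed
  ultimately show ?thesis by blast
qed

end
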